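(* Consider a double round-robin tournament with four teams, under the rules given in the context, after Matchday 4 (i.e. each team has played four matches). Independently of the tie-breaking rule (goal difference or head-to-head results), the second- and third-placed teams cannot be determined after Matchday 4. That is, whatever the results of Matchdays 1 to 4, there is no team that is guaranteed to be second in the final ranking, and there is no team that is guaranteed to be third in the final ranking.
   Context: Double round-robin tournament with four teams: each team plays each of the other three teams exactly twice (once at home, once away). The tournament consists of six rounds (Matchdays 1 to 6); in each round two matches are played so that every team plays exactly one match. The two matches of a round are played simultaneously, so after a given round exactly the results of the matches of that round and all previous rounds are known. Schedule assumption: a team can play its second match against another team only after it has played once against all other teams (so Matchdays 1-3 form a single round-robin, and so do Matchdays 4-6). Match results: the result of a match is a pair of non-negative integers (goals scored by the two teams), without an upper bound. A win is worth 3 points, a draw 1 point, a loss 0 points. Ranking: teams are ranked by total number of points. Ties in points are broken either by goal difference (total goals scored minus total goals conceded in all group matches, higher is better), or by head-to-head results/records (higher number of points obtained in the matches played among the tied teams, followed by superior goal difference in the matches played among the tied teams). The final ranking is the one after all six rounds. A team is guaranteed to have a given final position after Matchday 4 if it has this position in the final ranking for all possible results of the matches still to be played (Matchdays 5 and 6). *)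

theory Defs
  imports "HOL-Library.Cardinality"
begin

text \<open>A match is a pair (home team, away team).  A schedule maps each matchday to the set of
  matches played on it; only the values at 1, ..., 6 are relevant.\<close>

type_synonym 't match = "'t \<times> 't"
type_synonym 't schedule = "nat \<Rightarrow> 't match set"

text \<open>The result of a match is the pair (goals of the home team, goals of the away team).\<close>

type_synonym 't results = "'t match \<Rightarrow> nat \<times> nat"

definition plays_in :: "'t \<Rightarrow> 't match \<Rightarrow> bool" where
  "plays_in t m \<longleftrightarrow> t = fst m \<or> t = snd m"

definition meet :: "'t schedule \<Rightarrow> nat \<Rightarrow> 't \<Rightarrow> 't \<Rightarrow> bool" where
  "meet S r t u \<longleftrightarrow> (t, u) \<in> S r \<or> (u, t) \<in> S r"

text \<open>The last conjunct is the schedule assumption: a second match between \<open>t\<close> and \<open>u\<close> requires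
  that \<open>t\<close> has met every other team on an earlier matchday.\<close>

definition double_round_robin :: "'t schedule \<Rightarrow> bool" where
  "double_round_robin S \<longleftrightarrow>
     (\<forall>r\<in>{1..6}. card (S r) = 2 \<and> (\<forall>m\<in>S r. fst m \<noteq> snd m) \<and>
        (\<forall>t. \<exists>!m. m \<in> S r \<and> plays_in t m)) \<and>
     (\<forall>t u. t \<noteq> u \<longrightarrow> (\<exists>!r. r \<in> {1..6} \<and> (t, u) \<in> S r)) \<and>
     (\<forall>t u. \<forall>q\<in>{1..6}. \<forall>r\<in>{1..6}. q < r \<and> meet S q t u \<and> meet S r t u \<longrightarrow>
        (\<forall>v. v \<noteq> t \<longrightarrow> (\<exists>p\<in>{1..<r}. meet S p t v)))"

definition goals_for :: "'t results \<Rightarrow> 't match \<Rightarrow> 't \<Rightarrow> nat" where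
  "goals_for res m t = (if t = fst m then fst (res m) else snd (res m))"

definition goals_against :: "'t results \<Rightarrow> 't match \<Rightarrow> 't \<Rightarrow> nat" where
  "goals_against res m t = (if t = fst m then snd (res m) else fst (res m))"

definition match_points :: "'t results \<Rightarrow> 't match \<Rightarrow> 't \<Rightarrow> nat" where
  "match_points res m t =
     (if goals_for res m t > goals_against res m t then 3
      else if goals_for res m t = goals_against res m t then 1 else 0)"

text \<open>Over the whole tournament every ordered pair of distinct teams plays exactly one match, so
  the following are all matches of \<open>t\<close> among the teams in \<open>G\<close>; \<open>G = UNIV\<close> gives all its matches.\<close>

definition matches_among :: "'t set \<Rightarrow> 't \<Rightarrow> 't match set" where
  "matches_among G t = {m \<in> G \<times> G. fst m \<noteq> snd m \<and> plays_in t m}"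

definition points_among :: "'t set \<Rightarrow> 't results \<Rightarrow> 't \<Rightarrow> nat" where
  "points_among G res t = (\<Sum>m\<in>matches_among G t. match_points res m t)"

definition goal_diff_among :: "'t set \<Rightarrow> 't results \<Rightarrow> 't \<Rightarrow> int" where
  "goal_diff_among G res t =
     (\<Sum>m\<in>matches_among G t. int (goals_for res m t) - int (goals_against res m t))"

abbreviation points :: "'t results \<Rightarrow> 't \<Rightarrow> nat" where
  "points \<equiv> points_among UNIV"

abbreviation goal_diff :: "'t results \<Rightarrow> 't \<Rightarrow> int" where
  "goal_diff \<equiv> goal_diff_among UNIV"

datatype tie_break = Goal_Difference | Head_To_Head

text \<open>Only used for teams \<open>t\<close> and \<open>u\<close> with equal points; the tied teams are then all teams
  with that number of points.\<close>

fun wins_tie :: "tie_break \<Rightarrow> 't results \<Rightarrow> 't \<Rightarrow> 't \<Rightarrow> bool" where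
  "wins_tie Goal_Difference res t u \<longleftrightarrow> goal_diff res t > goal_diff res u"
| "wins_tie Head_To_Head res t u \<longleftrightarrow>
     (let G = {v. points res v = points res t} in
        points_among G res t > points_among G res u \<or>
        points_among G res t = points_among G res u \<and>
        goal_diff_among G res t > goal_diff_among G res u)"

definition ranked_above :: "tie_break \<Rightarrow> 't results \<Rightarrow> 't \<Rightarrow> 't \<Rightarrow> bool" where
  "ranked_above tb res t u \<longleftrightarrow>
     points res t > points res u \<or> points res t = points res u \<and> wins_tie tb res t u"

text \<open>A final ranking assigns positions 1, 2, ... to the teams, given the results of all matches.
  Teams that remain tied under \<open>ranked_above\<close> may be ordered in any way (further criteria,
  drawing of lots); statements are meant to be quantified over all such \<open>rk\<close>.\<close>

definition final_ranking :: "tie_break \<Rightarrow> ('t results \<Rightarrow> 't \<Rightarrow> nat) \<Rightarrow> bool" where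
  "final_ranking tb rk \<longleftrightarrow>
     (\<forall>res. bij_betw (rk res) UNIV {1..CARD('t)} \<and>
        (\<forall>t u. ranked_above tb res t u \<longrightarrow> rk res t < rk res u))"

definition guaranteed_position ::
  "'t schedule \<Rightarrow> ('t results \<Rightarrow> 't \<Rightarrow> nat) \<Rightarrow> nat \<Rightarrow> 't results \<Rightarrow> 't \<Rightarrow> nat \<Rightarrow> bool" where
  "guaranteed_position S rk d res t k \<longleftrightarrow>
     (\<forall>res'. (\<forall>r\<in>{1..d}. \<forall>m\<in>S r. res' m = res m) \<longrightarrow> rk res' t = k)"

end

theory Submission
  imports Defs
begin

text \<open>Matchdays 5 and 6 form a 4-cycle: team \<open>t\<close> still meets \<open>x\<close> and \<open>y\<close>, and so does the
  remaining team \<open>z\<close>.  Consider the four continuations in which each of \<open>t\<close> and \<open>z\<close> either wins or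
  loses both of its matches.  If \<open>t\<close> were second in all of them, comparing points alone would force
  some team to have 12 points after Matchday 4, \<open>t\<close> to have 6 and the other two to have 0; if
  \<open>t\<close> were third, two teams would have 12.  But all pairs of teams have met by then, so two teams
  can neither both have lost nor both have won all their matches.  Only points are compared, and only
  by weak inequalities, so the tie-breaking rule is irrelevant.\<close>

section \<open>Matches and opponents by matchday\<close>

text \<open>The description is meaningful only for \<open>r\<close> in \<open>{1..6}\<close>, where
  a double round-robin gives every team exactly one match.\<close>

definition match_of :: "'t schedule \<Rightarrow> nat \<Rightarrow> 't \<Rightarrow> 't match" where
  "match_of S r t = (THE m. m \<in> S r \<and> plays_in t m)"

definition opponent :: "'t schedule \<Rightarrow> nat \<Rightarrow> 't \<Rightarrow> 't" where
  "opponent S r t = (if fst (match_of S r t) = t then snd (match_of S r t) else fst (match_of S r t))"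

lemma ex1_match:
  assumes "double_round_robin S" "r \<in> {1..6}"
  shows "\<exists>!m. m \<in> S r \<and> plays_in t m"
  using assms unfolding double_round_robin_def by simp

lemma match_of:
  assumes "double_round_robin S" "r \<in> {1..6}"
  shows "match_of S r t \<in> S r" "plays_in t (match_of S r t)"
  using theI'[OF ex1_match[OF assms, of t]] by (simp_all add: match_of_def)

lemma match_of_eqI:
  assumes "double_round_robin S" "r \<in> {1..6}" "m \<in> S r" "plays_in t m"
  shows "match_of S r t = m"
  using ex1_match[OF assms(1,2), of t] match_of[OF assms(1,2), of t] assms(3,4) by blast

lemma scheduled_distinct:
  assumes "double_round_robin S" "r \<in> {1..6}" "m \<in> S r"
  shows "fst m \<noteq> snd m"
  using assms unfolding double_round_robin_def by simp

lemma ex1_round: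
  assumes "double_round_robin S" "t \<noteq> u"
  shows "\<exists>!r. r \<in> {1..6} \<and> (t, u) \<in> S r"
  using assms unfolding double_round_robin_def by simp

lemma met_all_before_rematch:
  assumes "double_round_robin S" "q \<in> {1..6}" "r \<in> {1..6}" "q < r"
    and "meet S q t u" "meet S r t u" "v \<noteq> t"
  obtains p where "p \<in> {1..<r}" "meet S p t v"
proof -
  have "\<forall>t u. \<forall>q\<in>{1..6}. \<forall>r\<in>{1..6}. q < r \<and> meet S q t u \<and> meet S r t u \<longrightarrow>
      (\<forall>v. v \<noteq> t \<longrightarrow> (\<exists>p\<in>{1..<r}. meet S p t v))"
    using assms(1) unfolding double_round_robin_def by (elim conjE)
  then show thesis using assms(2-) that by blast
qed

lemma round_unique:
  assumes "double_round_robin S" "q \<in> {1..6}" "r \<in> {1..6}" "m \<in> S q" "m \<in> S r"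
  shows "q = r"
proof -
  have "fst m \<noteq> snd m" using assms scheduled_distinct by blast
  from ex1_round[OF assms(1) this] show ?thesis using assms(2-) unfolding prod.collapse by blast
qed

lemma round_exists:
  assumes "double_round_robin S" "t \<noteq> u"
  obtains r where "r \<in> {1..6}" "(t, u) \<in> S r"
  using ex1_round[OF assms] by blast

lemma opponent_cases:
  assumes "double_round_robin S" "r \<in> {1..6}"
  shows "match_of S r t = (t, opponent S r t) \<or> match_of S r t = (opponent S r t, t)"
  using match_of(2)[OF assms, of t] unfolding plays_in_def opponent_def
  by (cases "match_of S r t") auto

lemma opponent_neq:
  assumes "double_round_robin S" "r \<in> {1..6}"
  shows "opponent S r t \<noteq> t"
  using opponent_cases[OF assms, of t] scheduled_distinct[OF assms match_of(1)[OF assms]]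
  by (metis fst_conv snd_conv)

lemma match_of_opponent:
  assumes "double_round_robin S" "r \<in> {1..6}"
  shows "match_of S r (opponent S r t) = match_of S r t"
  using opponent_cases[OF assms, of t] match_of(1)[OF assms, of t]
  by (intro match_of_eqI[OF assms]) (auto simp: plays_in_def)

lemma opponent_opponent:
  assumes "double_round_robin S" "r \<in> {1..6}"
  shows "opponent S r (opponent S r t) = t"
  using opponent_cases[OF assms, of t] opponent_neq[OF assms, of t] match_of_opponent[OF assms, of t]
  by (auto simp: opponent_def[of S r "opponent S r t"])

lemma opponent_eqI:
  assumes "double_round_robin S" "r \<in> {1..6}" "meet S r t u"
  shows "opponent S r t = u"
proof -
  from assms(3) obtain m where m: "m = (t, u) \<or> m = (u, t)" "m \<in> S r"
    unfolding meet_def by auto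
  then have "match_of S r t = m"
    by (intro match_of_eqI[OF assms(1,2)]) (auto simp: plays_in_def)
  then show ?thesis
    using m scheduled_distinct[OF assms(1,2) m(2)] by (auto simp: opponent_def)
qed

lemma meet_opponent:
  assumes "double_round_robin S" "r \<in> {1..6}"
  shows "meet S r t (opponent S r t)"
  using opponent_cases[OF assms, of t] match_of(1)[OF assms, of t] by (auto simp: meet_def)

section \<open>Structure of the last two matchdays\<close>

text \<open>If both opponents were the same team \<open>v\<close>, neither match against
  \<open>v\<close> would be left for earlier. Then \<open>t\<close> would spend Matchdays 1 to 3 on
  only two other teams and play a rematch before having met \<open>v\<close>, which the schedule
  assumption forbids.\<close>

lemma opponent_final_rounds_neq:
  fixes S :: "'t::finite schedule"
  assumes S: "double_round_robin S" and card: "CARD('t) = 4"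
  shows "opponent S 5 t \<noteq> opponent S 6 t"
proof
  assume eq: "opponent S 5 t = opponent S 6 t"
  define v where "v = opponent S 5 t"
  \<comment> \<open>A match is played on one matchday only, so these two must be the home and the
    away match between \<open>t\<close> and \<open>v\<close>.\<close>
  have "match_of S 5 t \<noteq> match_of S 6 t"
    using round_unique[OF S, of 5 6 "match_of S 5 t"] match_of(1)[OF S, of 5 t] match_of(1)[OF S, of 6 t] by auto
  then have all: "m \<in> S 5 \<union> S 6" if "m = (t, v) \<or> m = (v, t)" for m
    using that opponent_cases[OF S, of 5 t] opponent_cases[OF S, of 6 t] eq
      match_of(1)[OF S, of 5 t] match_of(1)[OF S, of 6 t] by (auto simp: v_def)
  have no_meet: "\<not> meet S p t v" if p: "p \<in> {1..4}" for p
  proof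
    assume "meet S p t v"
    then obtain m where "m \<in> S p" "m \<in> S 5 \<union> S 6" using all unfolding meet_def by blast
    then show False using round_unique[OF S, of p 5 m] round_unique[OF S, of p 6 m] p by auto
  qed
  have "(\<lambda>r. opponent S r t) ` {1..3} \<subseteq> UNIV - {t, v}"
  proof clarify
    fix r :: nat assume "r \<in> {1..3}"
    then show "opponent S r t \<in> UNIV - {t, v}"
      using meet_opponent[OF S, of r t] opponent_neq[OF S, of r t] no_meet[of r] by auto
  qed
  moreover have "card (UNIV - {t, v}) = 2"
    using card opponent_neq[OF S, of 5 t] by (subst card_Diff_subset) (auto simp: v_def)
  ultimately have "card ((\<lambda>r. opponent S r t) ` {1..3}) < card {1..3::nat}"
    using card_mono[of "UNIV - {t, v}" "(\<lambda>r. opponent S r t) ` {1..3}"] by simp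
  from pigeonhole[OF this] obtain q r where "q \<in> {1..3}" "r \<in> {1..3}" "q \<noteq> r"
    "opponent S q t = opponent S r t"
    unfolding inj_on_def by blast
  then obtain q r where qr: "q \<in> {1..3}" "r \<in> {1..3}" "q < r"
    "opponent S q t = opponent S r t"
    by (cases q r rule: linorder_cases) auto
  then have q6: "q \<in> {1..6}" and r6: "r \<in> {1..6}" by auto
  have "meet S q t (opponent S r t)"
    using meet_opponent[OF S q6, of t] qr(4) by simp
  moreover have "v \<noteq> t" using opponent_neq[OF S, of 5 t] by (simp add: v_def)
  ultimately obtain p where "p \<in> {1..<r}" "meet S p t v"
    using met_all_before_rematch[OF S q6 r6 qr(3) _ meet_opponent[OF S r6]] by blast
  then show False using no_meet[of p] qr(2) by auto
qed

text \<open>The home and the away match of the pair fall on different matchdays, since a team plays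
  once per matchday. They cannot fill Matchdays 5 and 6 by \<open>opponent_final_rounds_neq\<close>,
  so one of them is earlier.\<close>

lemma meet_before_matchday_5:
  fixes S :: "'t::finite schedule"
  assumes S: "double_round_robin S" and card: "CARD('t) = 4" and "t \<noteq> u"
  obtains r where "r \<in> {1..4}" "opponent S r t = u"
proof -
  obtain q where q: "q \<in> {1..6}" "(t, u) \<in> S q" using round_exists[OF S \<open>t \<noteq> u\<close>] .
  obtain r where r: "r \<in> {1..6}" "(u, t) \<in> S r" using round_exists[OF S \<open>t \<noteq> u\<close>[symmetric]] .
  have opp: "opponent S q t = u" "opponent S r t = u"
    using opponent_eqI[OF S q(1), of t u] opponent_eqI[OF S r(1), of t u] q(2) r(2)
    by (simp_all add: meet_def)
  have "q \<noteq> r"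
  proof
    assume "q = r"
    then show False
      using match_of_eqI[OF S q, of t] match_of_eqI[OF S r, of t] \<open>t \<noteq> u\<close>
      by (simp add: plays_in_def)
  qed
  have "q \<in> {1..4} \<or> r \<in> {1..4}"
  proof (rule ccontr)
    assume "\<not> ?thesis"
    then have "q = 5 \<and> r = 6 \<or> q = 6 \<and> r = 5"
      using q(1) r(1) \<open>q \<noteq> r\<close> by auto
    then show False using opp opponent_final_rounds_neq[OF S card, of t] by auto
  qed
  then show thesis using opp that by blast
qed

section \<open>Points after Matchday 4 and in chosen continuations\<close>

text \<open>Different matchdays give different matches of \<open>t\<close>, and each match of
  \<open>t\<close> is scheduled on some matchday, so the sum over matches can be reindexed.\<close>

lemma points_by_round:
  fixes S :: "'t::finite schedule"
  assumes S: "double_round_robin S"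
  shows "points res t = (\<Sum>r\<in>{1..6}. match_points res (match_of S r t) t)"
proof -
  have "bij_betw (\<lambda>r. match_of S r t) {1..6} (matches_among UNIV t)"
  proof (rule bij_betw_imageI)
    show "inj_on (\<lambda>r. match_of S r t) {1..6}"
      by (rule inj_onI) (metis match_of(1)[OF S] round_unique[OF S])
    show "(\<lambda>r. match_of S r t) ` {1..6} = matches_among UNIV t"
    proof (intro equalityI subsetI)
      fix m assume "m \<in> (\<lambda>r. match_of S r t) ` {1..6}"
      then show "m \<in> matches_among UNIV t"
        using match_of[OF S] scheduled_distinct[OF S] by (auto simp: matches_among_def)
    next
      fix m assume "m \<in> matches_among UNIV t"
      then have m: "fst m \<noteq> snd m" "plays_in t m" by (auto simp: matches_among_def)
      then obtain r where "r \<in> {1..6}" "m \<in> S r"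
        using round_exists[OF S, of "fst m" "snd m"] by auto
      then show "m \<in> (\<lambda>r. match_of S r t) ` {1..6}"
        using match_of_eqI[OF S _ _ m(2)] by blast
    qed
  qed
  then show ?thesis
    unfolding points_among_def by (rule sum.reindex_bij_betw[symmetric])
qed

definition points_after_4 :: "'t schedule \<Rightarrow> 't results \<Rightarrow> 't \<Rightarrow> nat" where
  "points_after_4 S res t = (\<Sum>r\<in>{1..4}. match_points res (match_of S r t) t)"

lemma match_points_le: "match_points res m t \<le> 3"
  by (simp add: match_points_def)

lemma points_after_4_le: "points_after_4 S res t \<le> 12"
  using sum_bounded_above[of "{1..4::nat}" "\<lambda>r. match_points res (match_of S r t) t" 3]
  by (simp add: points_after_4_def match_points_le)

text \<open>Among the first four matchdays is a match of \<open>t\<close> against \<open>u\<close>,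
  which yields 2 or 3 points in total. On the other three matchdays the two teams gain at most 6
  together, hence 3 + 18 = 21.\<close>

lemma points_after_4_pair:
  fixes S :: "'t::finite schedule"
  assumes S: "double_round_robin S" and card: "CARD('t) = 4" and "t \<noteq> u"
  shows "2 \<le> points_after_4 S res t + points_after_4 S res u"
    and "points_after_4 S res t + points_after_4 S res u \<le> 21"
proof -
  obtain r where r: "r \<in> {1..4}" "opponent S r t = u"
    using meet_before_matchday_5[OF assms] .
  let ?f = "\<lambda>r. match_points res (match_of S r t) t + match_points res (match_of S r u) u"
  have sum: "points_after_4 S res t + points_after_4 S res u = ?f r + (\<Sum>q\<in>{1..4} - {r}. ?f q)"
    using r(1) unfolding points_after_4_def
    by (simp only: sum.distrib[symmetric]) (rule sum.remove, auto)
  have r6: "r \<in> {1..6}" using r(1) by auto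
  have "match_of S r u = match_of S r t"
    using match_of_opponent[OF S r6, of t] r(2) by simp
  moreover have "match_of S r t = (t, u) \<or> match_of S r t = (u, t)"
    using opponent_cases[OF S r6, of t] r(2) by simp
  ultimately have f: "2 \<le> ?f r" "?f r \<le> 3"
    using \<open>t \<noteq> u\<close> by (auto simp: match_points_def goals_for_def goals_against_def)
  have "(\<Sum>q\<in>{1..4} - {r}. ?f q) \<le> of_nat (card ({1..4} - {r})) * 6"
    using add_mono[OF match_points_le[of res _ t] match_points_le[of res _ u]]
    by (intro sum_bounded_above) simp
  also have "\<dots> = 18" using r(1) by (simp add: card_Diff_singleton)
  finally show "2 \<le> points_after_4 S res t + points_after_4 S res u"
    "points_after_4 S res t + points_after_4 S res u \<le> 21"
    using sum f by linarith+
qed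

text \<open>Strengths \<open>w\<close> with three levels suffice to express the four continuations.\<close>

definition continuation :: "'t schedule \<Rightarrow> 't results \<Rightarrow> ('t \<Rightarrow> nat) \<Rightarrow> 't results" where
  "continuation S res w m =
     (if \<exists>r\<in>{1..4}. m \<in> S r then res m else (w (fst m), w (snd m)))"

definition score :: "('t \<Rightarrow> nat) \<Rightarrow> 't \<Rightarrow> 't \<Rightarrow> nat" where
  "score w t u = (if w t > w u then 3 else if w t = w u then 1 else 0)"

lemma points_continuation:
  fixes S :: "'t::finite schedule"
  assumes S: "double_round_robin S"
  shows "points (continuation S res w) t =
    points_after_4 S res t + score w t (opponent S 5 t) + score w t (opponent S 6 t)"
proof -
  let ?c = "continuation S res w"
  have early: "match_points ?c (match_of S r t) t = match_points res (match_of S r t) t"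
    if "r \<in> {1..4}" for r
  proof -
    have "match_of S r t \<in> S r" using match_of(1)[OF S] that by auto
    then have "?c (match_of S r t) = res (match_of S r t)"
      using that by (auto simp: continuation_def)
    then show ?thesis by (simp add: match_points_def goals_for_def goals_against_def)
  qed
  \<comment> \<open>Each team scores its own strength at home and away alike, so the venue is
    irrelevant to the points.\<close>
  have decided: "match_points res' m t = score w t u"
    if "m = (t, u) \<or> m = (u, t)" "u \<noteq> t" "res' m = (w (fst m), w (snd m))" for res' m u
    using that by (auto simp: match_points_def goals_for_def goals_against_def score_def)
  have late: "match_points ?c (match_of S r t) t = score w t (opponent S r t)"
    if "r \<in> {5, 6}" for r
  proof -
    have r: "r \<in> {1..6}" using that by auto
    \<comment> \<open>No match recurs on another matchday, so the result comes from the strengths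
      and not from \<open>res\<close>.\<close>
    have "\<not> (\<exists>q\<in>{1..4}. match_of S r t \<in> S q)"
    proof
      assume "\<exists>q\<in>{1..4}. match_of S r t \<in> S q"
      then obtain q where q: "q \<in> {1..4}" "match_of S r t \<in> S q" ..
      then have "q \<in> {1..6}" by simp
      from round_unique[OF S this r q(2) match_of(1)[OF S r]] show False
        using q(1) that by simp
    qed
    then have "?c (match_of S r t) = (w (fst (match_of S r t)), w (snd (match_of S r t)))"
      by (simp add: continuation_def)
    with decided[of "match_of S r t" "opponent S r t" ?c] show ?thesis
      using opponent_cases[OF S r, of t] opponent_neq[OF S r, of t] by blast
  qed
  have "{1..6::nat} = {1..4} \<union> {5, 6}" by auto
  then have "points ?c t = (\<Sum>r\<in>{1..4} \<union> {5, 6}. match_points ?c (match_of S r t) t)"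
    by (simp only: points_by_round[OF S])
  also have "\<dots> = (\<Sum>r\<in>{1..4}. match_points ?c (match_of S r t) t)
      + (\<Sum>r\<in>{5, 6}. match_points ?c (match_of S r t) t)"
    by (rule sum.union_disjoint) auto
  also have "(\<Sum>r\<in>{1..4}. match_points ?c (match_of S r t) t) = points_after_4 S res t"
    unfolding points_after_4_def by (intro sum.cong refl early)
  also have "(\<Sum>r\<in>{5, 6}. match_points ?c (match_of S r t) t) =
      score w t (opponent S 5 t) + score w t (opponent S 6 t)"
    using late[of 5] late[of 6] by simp
  finally show ?thesis by simp
qed

section \<open>From final positions to inequalities between points\<close>

lemma rank_less_imp_points_ge:
  assumes "final_ranking tb rk" "rk res t < rk res u"
  shows "points res u \<le> points res t"
proof (rule ccontr)
  assume "\<not> ?thesis"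
  then have "ranked_above tb res u t" by (simp add: ranked_above_def)
  then have "rk res u < rk res t" using assms(1) by (auto simp: final_ranking_def)
  then show False using assms(2) by simp
qed

text \<open>Second place leaves exactly one team above \<open>t\<close>, third place exactly two. A
  better position implies at least as many points under either tie-breaking rule, so each choice of
  the teams above gives one disjunct.\<close>

lemma final_ranking_points_cases:
  fixes rk :: "'t::finite results \<Rightarrow> 't \<Rightarrow> nat" and res :: "'t results"
  assumes rk: "final_ranking tb rk" and card: "CARD('t) = 4" and dist: "distinct [t, x, y, z]"
  defines "p \<equiv> points res"
  shows "rk res t = 2 \<Longrightarrow>
      p t \<le> p x \<and> p y \<le> p t \<and> p z \<le> p t \<or>
      p t \<le> p y \<and> p x \<le> p t \<and> p z \<le> p t \<or>
      p t \<le> p z \<and> p x \<le> p t \<and> p y \<le> p t"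
    and "rk res t = 3 \<Longrightarrow>
      p x \<le> p t \<and> p t \<le> p y \<and> p t \<le> p z \<or>
      p y \<le> p t \<and> p t \<le> p x \<and> p t \<le> p z \<or>
      p z \<le> p t \<and> p t \<le> p x \<and> p t \<le> p y"
proof -
  have bij: "bij_betw (rk res) UNIV {1..4}" using rk card by (simp add: final_ranking_def)
  have ranks: "rk res u \<in> {1..4}" for u using bij_betwE[OF bij] by blast
  have neq: "rk res u \<noteq> rk res v" if "u \<noteq> v" for u v
    using bij_betw_imp_inj_on[OF bij] that by (auto dest: injD)
  have less: "p v \<le> p u" if "rk res u < rk res v" for u v
    unfolding p_def using rank_less_imp_points_ge[OF rk that] .
  have arith: "a = 2 \<Longrightarrow> b < a \<and> a < c \<and> a < d \<or> c < a \<and> a < b \<and> a < d \<or> d < a \<and> a < b \<and> a < c"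
    "a = 3 \<Longrightarrow> a < b \<and> c < a \<and> d < a \<or> a < c \<and> b < a \<and> d < a \<or> a < d \<and> b < a \<and> c < a"
    if "a \<in> {1..4}" "b \<in> {1..4}" "c \<in> {1..4}" "d \<in> {1..4}" "distinct [a, b, c, d]"
    for a b c d :: nat
    using that unfolding atLeastAtMost_iff distinct.simps set_simps by (simp_all, presburger+)
  have "distinct [rk res t, rk res x, rk res y, rk res z]" using dist neq by auto
  note ranked = arith[OF ranks ranks ranks ranks this]
  show "rk res t = 2 \<Longrightarrow>
      p t \<le> p x \<and> p y \<le> p t \<and> p z \<le> p t \<or>
      p t \<le> p y \<and> p x \<le> p t \<and> p z \<le> p t \<or>
      p t \<le> p z \<and> p x \<le> p t \<and> p y \<le> p t"
    by (drule ranked(1)) (use less in blast)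
  show "rk res t = 3 \<Longrightarrow>
      p x \<le> p t \<and> p t \<le> p y \<and> p t \<le> p z \<or>
      p y \<le> p t \<and> p t \<le> p x \<and> p t \<le> p z \<or>
      p z \<le> p t \<and> p t \<le> p x \<and> p t \<le> p y"
    by (drule ranked(2)) (use less in blast)
qed

section \<open>Contradiction from four continuations\<close>

lemma not_guaranteed_middle:
  fixes S :: "'t::finite schedule"
  assumes card: "CARD('t) = 4" and S: "double_round_robin S" and rk: "final_ranking tb rk"
    and k: "k = 2 \<or> k = 3"
  shows "\<not> guaranteed_position S rk 4 res t k"
proof
  assume g: "guaranteed_position S rk 4 res t k"
  define x where "x = opponent S 5 t"
  define y where "y = opponent S 6 t"
  have "x \<noteq> t" "y \<noteq> t" "x \<noteq> y"
    using opponent_neq[OF S] opponent_final_rounds_neq[OF S card] by (auto simp: x_def y_def)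
  then have "card {t, x, y} = 3" by simp
  then have "card (UNIV - {t, x, y}) = 1" using card by (simp add: card_Diff_subset)
  then obtain z where z: "UNIV - {t, x, y} = {z}" by (rule card_1_singletonE)
  then have dist: "distinct [t, x, y, z]" using \<open>x \<noteq> t\<close> \<open>y \<noteq> t\<close> \<open>x \<noteq> y\<close> by auto
  have univ: "u \<in> {t, x, y, z}" for u using z by blast
  have inv5: "opponent S 5 (opponent S 5 u) = u" and inv6: "opponent S 6 (opponent S 6 u) = u"
    and ne5: "opponent S 5 u \<noteq> u" and ne6: "opponent S 6 u \<noteq> u" for u
    using opponent_opponent[OF S] opponent_neq[OF S] by auto
  have opp: "opponent S 5 t = x" "opponent S 6 t = y" "opponent S 5 x = t" "opponent S 6 y = t"
    using inv5[of t] inv6[of t] by (auto simp: x_def y_def)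
  \<comment> \<open>Opponents are mutual: \<open>t\<close> occupies \<open>x\<close> on Matchday 5
    and \<open>y\<close> on Matchday 6, which leaves \<open>z\<close> with \<open>y\<close> and then
    \<open>x\<close>.\<close>
  have "opponent S 5 z \<notin> {t, x, z}" "opponent S 6 z \<notin> {t, y, z}"
    using inv5[of z] inv6[of z] ne5[of z] ne6[of z] opp dist by auto
  then have oppz: "opponent S 5 z = y" "opponent S 6 z = x"
    using univ[of "opponent S 5 z"] univ[of "opponent S 6 z"] by auto
  then have oppxy: "opponent S 5 y = z" "opponent S 6 x = z"
    using inv5[of z] inv6[of z] by auto
  have fixed: "rk (continuation S res w) t = k" for w
  proof -
    have "\<forall>r\<in>{1..4}. \<forall>m\<in>S r. continuation S res w m = res m"
      unfolding continuation_def by (intro ballI if_P) blast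
    then show ?thesis using g unfolding guaranteed_position_def by blast
  qed
  define q where "q = points_after_4 S res"
  \<comment> \<open>Since \<open>x\<close> and \<open>y\<close> have strength 1, strength 2 means
    winning both remaining matches and strength 0 losing both; \<open>t\<close> and \<open>z\<close>
    do not meet again.\<close>
  define w where "w a b u = (if u = t then a else if u = z then b else 1)" for a b :: nat and u
  have scores: "points (continuation S res (w a b)) t = q t + 2 * (if a > 1 then 3 else if a = 1 then 1 else 0)"
    "points (continuation S res (w a b)) z = q z + 2 * (if b > 1 then 3 else if b = 1 then 1 else 0)"
    "points (continuation S res (w a b)) x =
       q x + (if a < 1 then 3 else if a = 1 then 1 else 0) + (if b < 1 then 3 else if b = 1 then 1 else 0)"
    "points (continuation S res (w a b)) y =
       q y + (if a < 1 then 3 else if a = 1 then 1 else 0) + (if b < 1 then 3 else if b = 1 then 1 else 0)"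
    for a b
    using dist unfolding points_continuation[OF S] q_def[symmetric] opp oppz oppxy
    by (auto simp: score_def w_def)
  have bounds: "q u \<le> 12" for u by (simp add: q_def points_after_4_le)
  have pair: "2 \<le> q u + q v" "q u + q v \<le> 21" if "u \<noteq> v" for u v
    using points_after_4_pair[OF S card that] by (auto simp: q_def)
  note facts = bounds[of t] bounds[of x] bounds[of y] bounds[of z]
    pair[of x y] pair[of x z] pair[of y z]
  have neq: "x \<noteq> y" "x \<noteq> z" "y \<noteq> z" using dist by auto
  show False
  proof (cases "k = 2")
    case True
    note cont = final_ranking_points_cases(1)[OF rk card dist, OF fixed[unfolded True]]
    \<comment> \<open>In \<open>w 0 0\<close> at most one team is above \<open>t\<close>, so
      \<open>q x + 6\<close> or \<open>q y + 6\<close> is at most \<open>q t\<close>, whence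
      \<open>q t\<close> is at least 6. In \<open>w 2 2\<close> and \<open>w 2 0\<close> some team
      must still reach \<open>q t + 6\<close>. Combining all four cases leaves only 12 points for
      one team, 6 for \<open>t\<close> and 0 for the other two, against the lower bound in
      \<open>pair\<close>.\<close>
    show False
      using cont[of "w 2 2"] cont[of "w 2 0"] cont[of "w 0 2"] cont[of "w 0 0"] facts neq
      unfolding scores by simp linarith
  next
    case False
    then have "k = 3" using k by simp
    note cont = final_ranking_points_cases(2)[OF rk card dist, OF fixed[unfolded this]]
    \<comment> \<open>This is the mirror image: replacing points after Matchday 4 by 12 minus points
      exchanges wins with losses and second with third place. Two teams would have 12 points,
      against the upper bound in \<open>pair\<close>.\<close>
    show False
      using cont[of "w 2 2"] cont[of "w 2 0"] cont[of "w 0 2"] cont[of "w 0 0"] facts neq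
      unfolding scores by simp linarith
  qed
qed

theorem proposition3p4:
  fixes S :: "'t::finite schedule"
    and tb :: tie_break
    and rk :: "'t results \<Rightarrow> 't \<Rightarrow> nat"
    and res :: "'t results"
  assumes "CARD('t) = 4"
    and "double_round_robin S"
    and "final_ranking tb rk"
  shows "(\<nexists>t. guaranteed_position S rk 4 res t 2) \<and> (\<nexists>t. guaranteed_position S rk 4 res t 3)"
  using not_guaranteed_middle[OF assms] by blast

end
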